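(* The function $h(t)=e^{1/t}-\psi'(t)$ is completely monotonic on $(0,\infty)$, that is, $(-1)^{k-1}h^{(k-1)}(t)\ge 0$ for all $k\in\mathbb{N}$ and all $t\in(0,\infty)$, and $$\lim_{t\to\infty}h(t)=1.$$
   Context: $\mathbb{N}=\{1,2,3,\dots\}$. $\Gamma(z)=\int_0^\infty t^{z-1}e^{-t}\,dt$ for $\Re z>0$ is the classical Euler gamma function, $\psi(t)=[\ln\Gamma(t)]'=\Gamma'(t)/\Gamma(t)$ is the digamma function, and $\psi'$ is its derivative (the trigamma function). $h^{(j)}$ denotes the $j$-th derivative of $h$, with $h^{(0)}=h$. *)

theory Defs
  imports "HOL-Analysis.Analysis"
begin

text \<open>
  Complete monotonicity, used for open intervals \<open>I\<close>. Since \<open>deriv\<close> is total, the existence of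
  all derivatives on \<open>I\<close> is required explicitly. As \<open>I\<close> is open, the values of the iterated
  derivatives on \<open>I\<close> do not depend on \<open>f\<close> outside \<open>I\<close>.
\<close>

definition completely_monotonic_on :: "real set \<Rightarrow> (real \<Rightarrow> real) \<Rightarrow> bool" where
  "completely_monotonic_on I f \<longleftrightarrow>
     (\<forall>n. \<forall>t\<in>I. (deriv ^^ n) f differentiable at t) \<and>
     (\<forall>k\<ge>1. \<forall>t\<in>I. (-1) ^ (k - 1) * (deriv ^^ (k - 1)) f t \<ge> 0)"

text \<open>
  The library defines \<^const>\<open>Digamma\<close> by a series. On the positive reals it is the
  logarithmic derivative of \<^const>\<open>Gamma\<close>:
\<close>

lemma deriv_ln_Gamma_eq_Digamma:
  fixes t :: real
  assumes "t > 0"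
  shows "deriv (\<lambda>x. ln (Gamma x)) t = Digamma t"
    and "deriv Gamma t / Gamma t = Digamma t"
proof -
  have t: "t \<notin> \<int>\<^sub>\<le>\<^sub>0"
    using assms by (auto elim!: nonpos_Ints_cases)
  have pos: "Gamma t > 0"
    using assms by (rule Gamma_real_pos)
  have G: "(Gamma has_field_derivative Gamma t * Digamma t) (at t)"
    using t by (rule has_field_derivative_Gamma)
  have "((\<lambda>x. ln (Gamma x)) has_field_derivative 1 / Gamma t * (Gamma t * Digamma t)) (at t)"
    by (rule DERIV_chain2[OF DERIV_ln_divide[OF pos] G])
  then show "deriv (\<lambda>x. ln (Gamma x)) t = Digamma t"
    using pos by (simp add: DERIV_imp_deriv)
  show "deriv Gamma t / Gamma t = Digamma t"
    using DERIV_imp_deriv[OF G] pos by simp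
qed

end

theory Submission
  imports Defs
begin

text \<open>
  The trigamma function has the asymptotic expansion
  \<open>\<psi>'(t) \<sim> 1 / t + 1 / (2 * t\<^sup>2) + 1 / (6 * t\<^sup>3) - 1 / (30 * t\<^sup>5) + \<dots>\<close>, and its first three terms are
  exactly the terms of order one to three in the power series of \<open>exp (1 / t)\<close>. Hence
  \<open>h(t) = 1 + E(t) + g(t)\<close>, where \<open>E(t)\<close> is the tail of the exponential series at \<open>1 / t\<close> from
  the fourth order on, and \<open>g(t) = 1 / t + 1 / (2 * t\<^sup>2) + 1 / (6 * t\<^sup>3) - \<psi>'(t)\<close>. Both are completely
  monotonic.

  For the tails of the exponential series this comes from the fact that the derivative of a tail
  is the tail starting one order earlier: differentiating \<open>E\<close> produces, up to the sign,
  that tail multiplied by \<open>1 / t\<^sup>2\<close>, and products of completely monotonic functions are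
  completely monotonic (\<open>completely_monotonic_upto_exp_tail\<close>).

  For \<open>g\<close>, the recurrence \<open>\<psi>'(t + 1) = \<psi>'(t) - 1 / t\<^sup>2\<close> leaves a rational function, in which
  everything of lower order cancels:
  \<open>g(t) - g(t + 1) = 1 / (6 * t\<^sup>3 * (t + 1)\<^sup>3)\<close> (\<open>trigamma_gap_difference\<close>). The right-hand
  side is completely monotonic as a product of reciprocals, so every \<open>(-1)\<^sup>j * g\<^bsup>(j)\<^esup>\<close> decreases along
  \<open>t, t + 1, t + 2, \<dots>\<close>. As it tends to \<open>0\<close> there, it is nonnegative
  (\<open>completely_monotonic_upto_if_difference\<close>).

  The limit of \<open>h\<close> follows from \<open>g \<ge> 0\<close>, which squeezes \<open>\<psi>'\<close> between \<open>0\<close> and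
  \<open>1 / t + 1 / (2 * t\<^sup>2) + 1 / (6 * t\<^sup>3)\<close>.
\<close>

section \<open>Complete monotonicity up to a finite order\<close>

text \<open>
  A recursion on the order, with the negated derivative \<open>g\<close> again being of the same kind, turns
  closure properties into inductions: the derivative of a product of such functions, say, is a
  sum of products of functions of one order less, which replaces the Leibniz rule for higher
  derivatives.
\<close>
primrec completely_monotonic_upto :: "real set \<Rightarrow> nat \<Rightarrow> (real \<Rightarrow> real) \<Rightarrow> bool" where
  "completely_monotonic_upto I 0 f \<longleftrightarrow> (\<forall>t\<in>I. f t \<ge> 0)"
| "completely_monotonic_upto I (Suc n) f \<longleftrightarrow> (\<forall>t\<in>I. f t \<ge> 0) \<and>
     (\<exists>g. completely_monotonic_upto I n g \<and> (\<forall>t\<in>I. (f has_real_derivative - g t) (at t)))"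

lemma completely_monotonic_upto_nonneg:
  "completely_monotonic_upto I n f \<Longrightarrow> t \<in> I \<Longrightarrow> f t \<ge> 0"
  by (cases n) auto

lemma completely_monotonic_upto_SucD:
  "completely_monotonic_upto I (Suc n) f \<Longrightarrow> completely_monotonic_upto I n f"
  by (induction n arbitrary: f) auto

lemma completely_monotonic_upto_cong:
  assumes "completely_monotonic_upto I n f" "open I" "\<And>t. t \<in> I \<Longrightarrow> f t = g t"
  shows "completely_monotonic_upto I n g"
proof (cases n)
  case 0
  then show ?thesis
    using assms by auto
next
  case (Suc m)
  then obtain f' where f': "completely_monotonic_upto I m f'"
    "\<And>t. t \<in> I \<Longrightarrow> (f has_real_derivative - f' t) (at t)"
    using assms(1) by auto
  have "(g has_real_derivative - f' t) (at t)" if "t \<in> I" for t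
    using has_field_derivative_transform_within_open[OF f'(2) assms(2)] that assms(3) by blast
  moreover have "g t \<ge> 0" if "t \<in> I" for t
    using completely_monotonic_upto_nonneg[OF assms(1) that] assms(3)[OF that] by simp
  ultimately show ?thesis
    using Suc f'(1) by auto
qed

lemma completely_monotonic_upto_const:
  "c \<ge> 0 \<Longrightarrow> completely_monotonic_upto I n (\<lambda>_. c)"
proof (induction n arbitrary: c)
  case (Suc n)
  have "completely_monotonic_upto I n (\<lambda>_. 0)"
    by (rule Suc.IH) simp
  moreover have "((\<lambda>_. c) has_real_derivative - 0) (at t)" for t :: real
    by simp
  ultimately show ?case
    using Suc.prems by (metis completely_monotonic_upto.simps(2))
qed simp

lemma completely_monotonic_upto_add:
  assumes "completely_monotonic_upto I n f" "completely_monotonic_upto I n g"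
  shows "completely_monotonic_upto I n (\<lambda>t. f t + g t)"
  using assms
proof (induction n arbitrary: f g)
  case (Suc n)
  from Suc.prems obtain f' g' where
    f': "completely_monotonic_upto I n f'" "\<And>t. t \<in> I \<Longrightarrow> (f has_real_derivative - f' t) (at t)" and
    g': "completely_monotonic_upto I n g'" "\<And>t. t \<in> I \<Longrightarrow> (g has_real_derivative - g' t) (at t)"
    by auto
  have "((\<lambda>t. f t + g t) has_real_derivative - (f' t + g' t)) (at t)" if "t \<in> I" for t
    using DERIV_add[OF f'(2) g'(2)] that by simp
  moreover have "f t + g t \<ge> 0" if "t \<in> I" for t
    using Suc.prems that by (simp add: completely_monotonic_upto_nonneg)
  ultimately show ?case
    using Suc.IH[OF f'(1) g'(1)] by auto
qed simp

lemma completely_monotonic_upto_mult: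
  assumes "completely_monotonic_upto I n f" "completely_monotonic_upto I n g"
  shows "completely_monotonic_upto I n (\<lambda>t. f t * g t)"
  using assms
proof (induction n arbitrary: f g)
  case (Suc n)
  from Suc.prems obtain f' g' where
    f': "completely_monotonic_upto I n f'" "\<And>t. t \<in> I \<Longrightarrow> (f has_real_derivative - f' t) (at t)" and
    g': "completely_monotonic_upto I n g'" "\<And>t. t \<in> I \<Longrightarrow> (g has_real_derivative - g' t) (at t)"
    by auto
  have "completely_monotonic_upto I n f" "completely_monotonic_upto I n g"
    using Suc.prems by (blast intro: completely_monotonic_upto_SucD)+
  then have "completely_monotonic_upto I n (\<lambda>t. f' t * g t + f t * g' t)"
    by (intro completely_monotonic_upto_add Suc.IH f'(1) g'(1))
  moreover have "((\<lambda>t. f t * g t) has_real_derivative - (f' t * g t + f t * g' t)) (at t)"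
    if "t \<in> I" for t
    using DERIV_mult[OF f'(2) g'(2)] that by (simp add: algebra_simps)
  moreover have "f t * g t \<ge> 0" if "t \<in> I" for t
    using Suc.prems that by (simp add: completely_monotonic_upto_nonneg)
  ultimately show ?case
    by auto
qed simp

text \<open>
  The negated derivative of \<open>1 / (t + a)\<close> is its own square, so closure under products gives the
  induction step.
\<close>

lemma completely_monotonic_upto_reciprocal:
  assumes "a \<ge> 0"
  shows "completely_monotonic_upto {0<..} n (\<lambda>t. 1 / (t + a))"
proof (induction n)
  case (Suc n)
  have "completely_monotonic_upto {0<..} n (\<lambda>t. 1 / (t + a) * (1 / (t + a)))"
    by (intro completely_monotonic_upto_mult Suc.IH)
  moreover have "((\<lambda>t. 1 / (t + a)) has_real_derivative - (1 / (t + a) * (1 / (t + a)))) (at t)"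
    if "t > 0" for t
    using assms that by (auto intro!: derivative_eq_intros)
  ultimately show ?case
    using assms by (auto simp del: times_divide_eq_left times_divide_eq_right)
qed (use assms in auto)

section \<open>From finite orders to iterated derivatives\<close>

text \<open>
  The equation \<open>D' j = - D (j + 1)\<close> is only known on \<open>I\<close>, while \<open>deriv\<close> iterates over functions on
  the whole line. Openness of \<open>I\<close> lets the values on \<open>I\<close> determine the next derivative.
\<close>

lemma higher_deriv_of_alternating_sequence:
  fixes D :: "nat \<Rightarrow> real \<Rightarrow> real"
  assumes "open I"
    and D: "\<And>j t. j < n \<Longrightarrow> t \<in> I \<Longrightarrow> (D j has_real_derivative - D (Suc j) t) (at t)"
  shows "j \<le> n \<Longrightarrow> t \<in> I \<Longrightarrow> (deriv ^^ j) (D 0) t = (-1) ^ j * D j t"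
    and "j < n \<Longrightarrow> t \<in> I \<Longrightarrow> (deriv ^^ j) (D 0) differentiable at t"
proof -
  have step: "((deriv ^^ j) (D 0) has_real_derivative (-1) ^ Suc j * D (Suc j) t) (at t)"
    if "j < n" "t \<in> I" and eq: "\<And>s. s \<in> I \<Longrightarrow> (deriv ^^ j) (D 0) s = (-1) ^ j * D j s" for j t
  proof (rule has_field_derivative_transform_within_open[OF _ \<open>open I\<close> \<open>t \<in> I\<close>])
    show "((\<lambda>s. (-1) ^ j * D j s) has_real_derivative (-1) ^ Suc j * D (Suc j) t) (at t)"
      using DERIV_cmult[OF D[OF that(1,2)], of "(-1) ^ j"] by simp
  qed (use eq in simp)
  have vals: "(deriv ^^ j) (D 0) t = (-1) ^ j * D j t" if "j \<le> n" "t \<in> I" for j t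
    using that
  proof (induction j arbitrary: t)
    case (Suc j)
    have "((deriv ^^ j) (D 0) has_real_derivative (-1) ^ Suc j * D (Suc j) t) (at t)"
      using Suc by (intro step) auto
    then show ?case
      by (simp add: DERIV_imp_deriv)
  qed simp
  then show "j \<le> n \<Longrightarrow> t \<in> I \<Longrightarrow> (deriv ^^ j) (D 0) t = (-1) ^ j * D j t" .
  show "(deriv ^^ j) (D 0) differentiable at t" if "j < n" "t \<in> I"
    using step[OF that vals] that by (auto simp: real_differentiable_def)
qed

text \<open>
  The recursion only provides one derivative at a time; unrolling it collects them into a
  sequence to which the preceding lemma applies.
\<close>

lemma completely_monotonic_upto_obtain_sequence:
  assumes "completely_monotonic_upto I n f"
  obtains D where "D 0 = f" "\<And>j t. j \<le> n \<Longrightarrow> t \<in> I \<Longrightarrow> D j t \<ge> 0"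
    "\<And>j t. j < n \<Longrightarrow> t \<in> I \<Longrightarrow> (D j has_real_derivative - D (Suc j) t) (at t)"
  using assms
proof (induction n arbitrary: f thesis)
  case 0
  show ?case
    by (rule 0(1)[of "\<lambda>_. f"]) (use 0(2) in auto)
next
  case (Suc n)
  from Suc.prems(2) obtain g where
    g: "completely_monotonic_upto I n g" "\<And>t. t \<in> I \<Longrightarrow> (f has_real_derivative - g t) (at t)"
    by auto
  obtain D where D: "D 0 = g" "\<And>j t. j \<le> n \<Longrightarrow> t \<in> I \<Longrightarrow> D j t \<ge> 0"
    "\<And>j t. j < n \<Longrightarrow> t \<in> I \<Longrightarrow> (D j has_real_derivative - D (Suc j) t) (at t)"
    using Suc.IH[OF _ g(1)] by blast
  show ?case
  proof (rule Suc.prems(1)[of "case_nat f D"])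
    show "case_nat f D j t \<ge> 0" if "j \<le> Suc n" "t \<in> I" for j t
      using that D(2) completely_monotonic_upto_nonneg[OF Suc.prems(2)] by (cases j) auto
    show "(case_nat f D j has_real_derivative - case_nat f D (Suc j) t) (at t)"
      if "j < Suc n" "t \<in> I" for j t
      using that D(1,3) g(2) by (cases j) auto
  qed simp
qed

lemma completely_monotonic_upto_imp_higher_deriv:
  assumes "completely_monotonic_upto I n f" "open I" "t \<in> I"
  shows "j \<le> n \<Longrightarrow> (-1) ^ j * (deriv ^^ j) f t \<ge> 0"
    and "j < n \<Longrightarrow> (deriv ^^ j) f differentiable at t"
proof -
  obtain D where D: "D 0 = f" "\<And>j t. j \<le> n \<Longrightarrow> t \<in> I \<Longrightarrow> D j t \<ge> 0"
    "\<And>j t. j < n \<Longrightarrow> t \<in> I \<Longrightarrow> (D j has_real_derivative - D (Suc j) t) (at t)"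
    using completely_monotonic_upto_obtain_sequence[OF assms(1)] by blast
  note higher = higher_deriv_of_alternating_sequence[where D = D, OF \<open>open I\<close> D(3), unfolded D(1)]
  show "(-1) ^ j * (deriv ^^ j) f t \<ge> 0" if "j \<le> n"
    using higher(1)[of n j t] D(2)[OF that assms(3)] that assms(3)
    by (simp flip: mult.assoc power_add)
  show "(deriv ^^ j) f differentiable at t" if "j < n"
    using higher(2)[of n j t] that assms(3) by simp
qed

lemma completely_monotonic_onI:
  assumes "open I" "\<And>n. completely_monotonic_upto I n f"
  shows "completely_monotonic_on I f"
  unfolding completely_monotonic_on_def
  using completely_monotonic_upto_imp_higher_deriv[OF assms(2,1)] by blast

section \<open>A criterion by unit differences\<close>

text \<open>
  The signed derivatives \<open>D j\<close> inherit \<open>D j (t + 1) \<le> D j t\<close> from the complete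
  monotonicity of the difference of \<open>D 0\<close>. Iterating this bounds \<open>D j t\<close> from below by
  \<open>D j (t + N)\<close> for every \<open>N\<close>, hence by its limit \<open>0\<close>.
\<close>

lemma completely_monotonic_upto_if_difference:
  fixes D :: "nat \<Rightarrow> real \<Rightarrow> real"
  assumes D: "\<And>j t. t > 0 \<Longrightarrow> (D j has_real_derivative - D (Suc j) t) (at t)"
    and lim: "\<And>j t. t > 0 \<Longrightarrow> (\<lambda>N. D j (t + real N)) \<longlonglongrightarrow> 0"
    and diff: "\<And>n. completely_monotonic_upto {0<..} n (\<lambda>t. D 0 t - D 0 (t + 1))"
  shows "completely_monotonic_upto {0<..} n (D j)"
proof -
  have decr: "D j (t + 1) \<le> D j t" if "t > 0" for j t
  proof -
    define E where "E j t = D j t - D j (t + 1)" for j t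
    have E: "(E i has_real_derivative - E (Suc i) s) (at s)" if "s > 0" for i s
    proof -
      have "((\<lambda>s. D i (s + 1)) has_real_derivative - D (Suc i) (s + 1)) (at s)"
        using D[of "s + 1" i] that by (simp add: DERIV_shift)
      from DERIV_diff[OF D[OF that, of i] this] show ?thesis
        by (simp add: E_def[abs_def])
    qed
    have "(deriv ^^ j) (E 0) t = (-1) ^ j * E j t"
      by (rule higher_deriv_of_alternating_sequence(1)[of "{0<..}" j]) (use E that in auto)
    moreover have "(-1) ^ j * (deriv ^^ j) (E 0) t \<ge> 0"
      using diff[of j] that
      by (intro completely_monotonic_upto_imp_higher_deriv(1)[of "{0<..}" j]) (auto simp: E_def[abs_def])
    ultimately have "E j t \<ge> 0"
      by (simp flip: mult.assoc power_add)
    then show ?thesis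
      by (simp add: E_def)
  qed
  have nonneg: "D j t \<ge> 0" if "t > 0" for j t
  proof (rule LIMSEQ_le_const2[OF lim[OF that]])
    have "D j (t + real N) \<le> D j t" for N
    proof (induction N)
      case (Suc N)
      then show ?case
        using decr[of "t + real N" j] that by (simp add: add_ac)
    qed simp
    then show "\<exists>N. \<forall>n\<ge>N. D j (t + real n) \<le> D j t"
      by blast
  qed
  show ?thesis
    using D nonneg by (induction n arbitrary: j) auto
qed

section \<open>Tails of the exponential series\<close>

definition exp_tail :: "nat \<Rightarrow> real \<Rightarrow> real" where
  "exp_tail m x = exp x - (\<Sum>k<m. x ^ k / fact k)"

lemma exp_tail_nonneg:
  assumes "x \<ge> 0"
  shows "exp_tail m x \<ge> 0"
proof -
  have s: "(\<lambda>k. x ^ k / fact k) sums exp x"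
    using exp_converges[of x] by (simp add: divide_inverse mult.commute)
  have "(\<Sum>k<m. x ^ k / fact k) \<le> (\<Sum>k. x ^ k / fact k)"
    using assms by (intro sum_le_suminf sums_summable[OF s]) auto
  then show ?thesis
    using sums_unique[OF s] by (simp add: exp_tail_def)
qed

text \<open>
  For \<open>m = 0\<close> the tail is the exponential function itself, its own derivative. The truncated
  subtraction covers this case.
\<close>

lemma has_real_derivative_exp_tail:
  "(exp_tail m has_real_derivative exp_tail (m - 1) x) (at x)"
proof -
  have "((\<lambda>x. \<Sum>k<m. x ^ k / fact k) has_real_derivative (\<Sum>k<m - 1. x ^ k / fact k)) (at x)"
  proof (cases m)
    case (Suc l)
    have "((\<lambda>x. \<Sum>k<Suc l. x ^ k / fact k) has_real_derivative
        (\<Sum>k<Suc l. real k * x ^ (k - 1) / fact k)) (at x)"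
      by (intro DERIV_sum) (auto intro!: derivative_eq_intros)
    also have "(\<Sum>k<Suc l. real k * x ^ (k - 1) / fact k) = (\<Sum>k<l. x ^ k / fact k)"
      by (subst sum.lessThan_Suc_shift) (simp add: field_simps del: of_nat_Suc)
    finally show ?thesis
      using Suc by simp
  qed simp
  from DERIV_diff[OF DERIV_exp this] show ?thesis
    by (simp add: exp_tail_def[abs_def])
qed

text \<open>
  Differentiation changes the tail and multiplies it by \<open>1 / t\<^sup>2\<close>, so the induction over the order
  treats all tails at once and relies on closure under products.
\<close>

lemma completely_monotonic_upto_exp_tail:
  "completely_monotonic_upto {0<..} n (\<lambda>t. exp_tail m (1 / t))"
proof (induction n arbitrary: m)
  case (Suc n)
  have "completely_monotonic_upto {0<..} n (\<lambda>t. exp_tail (m - 1) (1 / t) * (1 / t * (1 / t)))"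
    using completely_monotonic_upto_reciprocal[of 0 n]
    by (intro completely_monotonic_upto_mult Suc.IH) simp_all
  moreover have "((\<lambda>t. exp_tail m (1 / t)) has_real_derivative
      - (exp_tail (m - 1) (1 / t) * (1 / t * (1 / t)))) (at t)" if "t > 0" for t
  proof -
    have "((\<lambda>t. 1 / t) has_real_derivative - (1 / t * (1 / t))) (at t)"
      using that by (auto intro!: derivative_eq_intros)
    from DERIV_chain2[OF has_real_derivative_exp_tail this] show ?thesis
      by simp
  qed
  ultimately show ?case
    by (auto simp: exp_tail_nonneg simp del: times_divide_eq_left times_divide_eq_right)
qed (simp add: exp_tail_nonneg)

section \<open>Trigamma and the first terms of its asymptotic expansion\<close>

lemma pos_not_nonpos_Ints: "t \<notin> \<int>\<^sub>\<le>\<^sub>0" if "t > 0" for t :: real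
  using that by (auto elim!: nonpos_Ints_cases)

text \<open>
  By the recurrence, \<open>Polygamma n (t + N)\<close> is the defining series of \<open>Polygamma n t\<close> without its
  first \<open>N\<close> terms, up to a constant factor: a tail of a convergent series.
\<close>

lemma Polygamma_tendsto_0_at_shifts:
  fixes t :: real
  assumes "t > 0" "n > 0"
  shows "(\<lambda>N. Polygamma n (t + real N)) \<longlonglongrightarrow> 0"
proof -
  have "(\<lambda>N. \<Sum>k<N. 1 / (t + real k) ^ Suc n) \<longlonglongrightarrow> (-1) ^ Suc n * Polygamma n t / fact n"
    using Polygamma_LIMSEQ[of t n] assms by (simp add: sums_def inverse_eq_divide)
  then have "(\<lambda>N. Polygamma n t + (-1) ^ n * fact n * (\<Sum>k<N. 1 / (t + real k) ^ Suc n))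
      \<longlonglongrightarrow> Polygamma n t + (-1) ^ n * fact n * ((-1) ^ Suc n * Polygamma n t / fact n)"
    by (intro tendsto_intros)
  also have "Polygamma n t + (-1) ^ n * fact n * ((-1) ^ Suc n * Polygamma n t / fact n) = 0"
    by (simp flip: mult.assoc power_add)
  finally show ?thesis
    using Polygamma_plus_of_nat[of _ t n] pos_not_nonpos_Ints[OF assms(1)] assms
    by (subst Polygamma_plus_of_nat) (auto simp: add_eq_0_iff2)
qed

text \<open>
  For \<open>j = 0\<close> this is \<open>1 / t + 1 / (2 * t\<^sup>2) + 1 / (6 * t\<^sup>3) - \<psi>'(t)\<close>; in general it is the \<open>j\<close>-th
  derivative of that function with the sign \<open>(-1)\<^sup>j\<close>. The factor \<open>12\<close> is \<open>6 * 2!\<close>, since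
  the \<open>j\<close>-th derivative of \<open>1 / t\<^sup>3\<close> carries \<open>(j + 2)! / 2!\<close>. All three
  rational terms have the shape \<open>i! / (c * t\<^bsup>i + 1\<^esup>)\<close>, whose negated derivative is the same
  expression with \<open>i + 1\<close>.
\<close>

definition trigamma_gap :: "nat \<Rightarrow> real \<Rightarrow> real" where
  "trigamma_gap j t = fact j / (1 * t ^ Suc j) + fact (Suc j) / (2 * t ^ Suc (Suc j))
     + fact (Suc (Suc j)) / (12 * t ^ Suc (Suc (Suc j))) - (-1) ^ j * Polygamma (Suc j) t"

lemma has_real_derivative_trigamma_gap:
  assumes "t > 0"
  shows "(trigamma_gap j has_real_derivative - trigamma_gap (Suc j) t) (at t)"
proof -
  have pow: "((\<lambda>t. fact i / (c * t ^ Suc i)) has_real_derivative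
      - (fact (Suc i) / (c * t ^ Suc (Suc i)))) (at t)"
    if "c > 0" for i and c :: real
  proof -
    have "((\<lambda>t. t ^ Suc i) has_real_derivative real (Suc i) * t ^ i) (at t)"
      using DERIV_pow[of "Suc i" t] by simp
    from DERIV_cmult[OF DERIV_inverse_fun[OF this], of "fact i / c"]
    have "((\<lambda>t. fact i / (c * t ^ Suc i)) has_real_derivative fact i / c *
        - (inverse (t ^ Suc i) * (real (Suc i) * t ^ i) * inverse (t ^ Suc i))) (at t)"
      using assms by (simp add: divide_inverse mult_ac)
    also have "fact i / c * - (inverse (t ^ Suc i) * (real (Suc i) * t ^ i) * inverse (t ^ Suc i))
        = - (fact (Suc i) / (c * t ^ Suc (Suc i)))"
      using assms that by (simp add: field_simps)
    finally show ?thesis .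
  qed
  have "(Polygamma (Suc j) has_real_derivative Polygamma (Suc (Suc j)) t) (at t)"
    using pos_not_nonpos_Ints[OF assms] by (rule has_field_derivative_Polygamma)
  from DERIV_diff[OF DERIV_add[OF DERIV_add[OF pow[of 1 j] pow[of 2 "Suc j"]]
      pow[of 12 "Suc (Suc j)"]] DERIV_cmult[OF this, of "(-1) ^ j"]]
  show ?thesis
    unfolding trigamma_gap_def[abs_def] by (simp del: fact_Suc power_Suc add: power_Suc[of "-1"])
qed

lemma trigamma_gap_tendsto_0_at_shifts:
  assumes "t > 0"
  shows "(\<lambda>N. trigamma_gap j (t + real N)) \<longlonglongrightarrow> 0"
proof -
  have pow: "(\<lambda>N. c / (d * (t + real N) ^ Suc i)) \<longlonglongrightarrow> 0" if "d > 0" for c d i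
  proof -
    have "filterlim (\<lambda>N. d * (t + real N) ^ Suc i) at_top sequentially"
      using that
      by (intro filterlim_tendsto_pos_mult_at_top[OF tendsto_const] filterlim_pow_at_top)
        (auto, real_asymp)
    then show ?thesis
      by (intro tendsto_divide_0[OF tendsto_const] filterlim_at_top_imp_at_infinity)
  qed
  have "(\<lambda>N. trigamma_gap j (t + real N)) \<longlonglongrightarrow> 0 + 0 + 0 - (-1) ^ j * 0"
    unfolding trigamma_gap_def
    by (intro tendsto_add tendsto_diff tendsto_mult[OF tendsto_const] pow
        Polygamma_tendsto_0_at_shifts assms) simp_all
  then show ?thesis
    by simp
qed

text \<open>
  Over the common denominator \<open>6 * t\<^sup>3 * (t + 1)\<^sup>3\<close> the numerator has degree four a priori;
  the coefficients \<open>1\<close>, \<open>1 / 2\<close> and \<open>1 / 6\<close> are what reduces it to the constant \<open>1\<close>.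
\<close>

lemma trigamma_gap_difference:
  assumes "t > 0"
  shows "trigamma_gap 0 t - trigamma_gap 0 (t + 1) = 1 / (6 * t ^ 3 * (t + 1) ^ 3)"
proof -
  have "Polygamma 1 (t + 1) = Polygamma 1 t - 1 / t ^ 2"
    using Polygamma_plus1[of t 1] assms by (simp add: eval_nat_numeral)
  moreover have "1 / t + 1 / (2 * t ^ 2) + 1 / (6 * t ^ 3)
      - (1 / (t + 1) + 1 / (2 * (t + 1) ^ 2) + 1 / (6 * (t + 1) ^ 3)) - 1 / t ^ 2
      = 1 / (6 * t ^ 3 * (t + 1) ^ 3)"
    using assms by (simp add: divide_simps) algebra
  ultimately show ?thesis
    by (simp add: trigamma_gap_def eval_nat_numeral)
qed

lemma completely_monotonic_upto_trigamma_gap: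
  "completely_monotonic_upto {0<..} n (trigamma_gap 0)"
proof (rule completely_monotonic_upto_if_difference)
  fix n
  have r: "completely_monotonic_upto {0<..} n (\<lambda>t. 1 / (t + a) * (1 / (t + a) * (1 / (t + a))))"
    if "a \<ge> 0" for a
    using that by (intro completely_monotonic_upto_mult completely_monotonic_upto_reciprocal)
  \<comment> \<open>The summand \<open>0\<close> makes \<open>1 / t\<close> an instance of the shifted reciprocals.\<close>
  have "completely_monotonic_upto {0<..} n (\<lambda>t. 1 / 6 * (1 / (t + 0) * (1 / (t + 0) * (1 / (t + 0)))
      * (1 / (t + 1) * (1 / (t + 1) * (1 / (t + 1))))))"
    by (intro completely_monotonic_upto_mult[OF completely_monotonic_upto_const]
        completely_monotonic_upto_mult[OF r r]) simp_all
  then show "completely_monotonic_upto {0<..} n (\<lambda>t. trigamma_gap 0 t - trigamma_gap 0 (t + 1))"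
    by (rule completely_monotonic_upto_cong)
      (auto simp: trigamma_gap_difference eval_nat_numeral)
qed (simp_all add: has_real_derivative_trigamma_gap trigamma_gap_tendsto_0_at_shifts)

lemma Polygamma_1_nonneg: "Polygamma 1 t \<ge> 0" if "t > 0" for t :: real
proof -
  have "(\<lambda>k. inverse ((t + real k) ^ 2)) sums Polygamma 1 t"
    using Polygamma_LIMSEQ[of t 1] that by (simp add: eval_nat_numeral)
  then show ?thesis
    by (rule sums_le[OF _ sums_zero, rotated]) simp
qed

lemma Polygamma_1_tendsto_0: "(Polygamma 1 \<longlongrightarrow> (0::real)) at_top"
proof (rule tendsto_sandwich[OF _ _ tendsto_const])
  show "\<forall>\<^sub>F t in at_top. 0 \<le> Polygamma 1 (t::real)"
    using eventually_gt_at_top[of 0] by eventually_elim (rule Polygamma_1_nonneg)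
  show "\<forall>\<^sub>F t in at_top. Polygamma 1 t \<le> 1 / t + 1 / (2 * t ^ 2) + 1 / (6 * t ^ 3 :: real)"
    using eventually_gt_at_top[of 0]
  proof eventually_elim
    case (elim t)
    have "trigamma_gap 0 t \<ge> 0"
      using completely_monotonic_upto_nonneg[OF completely_monotonic_upto_trigamma_gap] elim by simp
    then show ?case
      by (simp add: trigamma_gap_def eval_nat_numeral)
  qed
  show "((\<lambda>t::real. 1 / t + 1 / (2 * t ^ 2) + 1 / (6 * t ^ 3)) \<longlongrightarrow> 0) at_top"
    by real_asymp
qed

section \<open>The function \<open>exp (1 / t) - \<psi>'(t)\<close>\<close>

theorem theorem1p1:
  fixes h :: "real \<Rightarrow> real"
  defines "h \<equiv> (\<lambda>t. exp (1 / t) - deriv Digamma t)"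
  shows "completely_monotonic_on {0<..} h \<and> (h \<longlongrightarrow> 1) at_top"
proof
  have h: "h t = exp (1 / t) - Polygamma 1 t" if "t > 0" for t
    using deriv_Polygamma[OF pos_not_nonpos_Ints[OF that], of 0] by (simp add: h_def)
  have split: "1 + exp_tail 4 (1 / t) + trigamma_gap 0 t = h t" if "t > 0" for t
    using that
    by (simp add: h exp_tail_def trigamma_gap_def eval_nat_numeral power_divide field_simps)
  show "completely_monotonic_on {0<..} h"
  proof (rule completely_monotonic_onI)
    fix n
    have "completely_monotonic_upto {0<..} n (\<lambda>t. 1 + exp_tail 4 (1 / t) + trigamma_gap 0 t)"
      by (intro completely_monotonic_upto_add completely_monotonic_upto_const
          completely_monotonic_upto_exp_tail completely_monotonic_upto_trigamma_gap) simp
    then show "completely_monotonic_upto {0<..} n h"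
      by (rule completely_monotonic_upto_cong) (use split in auto)
  qed simp
  have "((\<lambda>t::real. exp (1 / t)) \<longlongrightarrow> 1) at_top"
    by real_asymp
  from tendsto_diff[OF this Polygamma_1_tendsto_0]
  have "((\<lambda>t. exp (1 / t) - Polygamma 1 t) \<longlongrightarrow> (1::real)) at_top"
    by simp
  then show "(h \<longlongrightarrow> 1) at_top"
    by (rule Lim_transform_eventually)
      (use eventually_gt_at_top[of 0] in eventually_elim, simp add: h)
qed

end
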